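(* Let $\hbar>0$, let $\Sigma$ be a real symmetric positive definite $2n\times 2n$ matrix satisfying the quantization condition $\Sigma+\frac{i\hbar}{2}J\geq 0$ (equivalently, $M^{-1}+iJ\geq 0$ where $M=\frac{\hbar}{2}\Sigma^{-1}$), and let $$\Omega=\{z\in\mathbb{R}^{2n}:\tfrac12\Sigma^{-1}z\cdot z\leq 1\}=\{z\in\mathbb{R}^{2n}: Mz\cdot z\leq\hbar\}$$ be the associated covariance ellipsoid. Then the orthogonal projections $\Omega_X=\Pi_X\Omega\subset\mathbb{R}^n_x$ and $\Omega_P=\Pi_P\Omega\subset\mathbb{R}^n_p$ form a quantum dual pair, that is, $\Omega_X^{\hbar}\subset\Omega_P$.
   Context: Phase space is $\mathbb{R}^{2n}=\mathbb{R}^n_x\times\mathbb{R}^n_p$ with points $z=(x,p)$, and $\Pi_X(x,p)=x$, $\Pi_P(x,p)=p$. The standard symplectic matrix is $J=\begin{pmatrix}0&I_{n\times n}\\-I_{n\times n}&0\end{pmatrix}$. For a complex Hermitian matrix $K$, $K\geq 0$ means that $K$ is positive semidefinite. For a convex body $X\subset\mathbb{R}^n_x$ containing $0$ in its interior, its polar dual is $X^{\hbar}=\{p\in\mathbb{R}^n_p: p\cdot x\leq\hbar\text{ for all }x\in X\}$. A pair $(X,P)$ of symmetric convex bodies (compact convex sets with non-empty interior, $X=-X$, $P=-P$), $X\subset\mathbb{R}^n_x$, $P\subset\mathbb{R}^n_p$, is called a quantum dual pair if $X^{\hbar}\subset P$. *)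

theory Defs
  imports "HOL-Analysis.Analysis"
begin

text \<open>Phase space is \<^typ>\<open>real^('n + 'n)\<close>: the \<open>Inl\<close> coordinates of a point \<open>z = (x, p)\<close> are the
  position \<open>x\<close>, the \<open>Inr\<close> coordinates are the momentum \<open>p\<close>.\<close>

definition proj_X :: "real^('n + 'n) \<Rightarrow> real^'n::finite"
  where "proj_X z = (\<chi> i. z $ Inl i)"

definition proj_P :: "real^('n + 'n) \<Rightarrow> real^'n::finite"
  where "proj_P z = (\<chi> i. z $ Inr i)"

definition J_matrix :: "real^('n + 'n)^('n + 'n::finite)"
  where "J_matrix = (\<chi> r c. case (r, c) of
            (Inl i, Inr j) \<Rightarrow> (if i = j then 1 else 0)
          | (Inr i, Inl j) \<Rightarrow> - (if i = j then 1 else 0)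
          | _ \<Rightarrow> 0)"

definition pos_def_matrix :: "real^'m^'m::finite \<Rightarrow> bool"
  where "pos_def_matrix A \<longleftrightarrow> transpose A = A \<and> (\<forall>v. v \<noteq> 0 \<longrightarrow> (A *v v) \<bullet> v > 0)"

definition hermitian_matrix :: "complex^'m^'m::finite \<Rightarrow> bool"
  where "hermitian_matrix K \<longleftrightarrow> map_matrix cnj (transpose K) = K"

text \<open>For hermitian \<open>K\<close> the form \<open>v\<^sup>* K v\<close> below is automatically real, so taking its real part loses
  nothing.\<close>

definition pos_semidef_matrix :: "complex^'m^'m::finite \<Rightarrow> bool"
  where "pos_semidef_matrix K \<longleftrightarrow>
    hermitian_matrix K \<and> (\<forall>v. Re (\<Sum>j\<in>UNIV. cnj (v $ j) * (K *v v) $ j) \<ge> 0)"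

definition plus_i_times :: "real^'m^'m \<Rightarrow> real^'m^'m \<Rightarrow> complex^'m^'m::finite"
  where "plus_i_times A B = (\<chi> j k. complex_of_real (A $ j $ k) + \<i> * complex_of_real (B $ j $ k))"

definition quantization_condition :: "real \<Rightarrow> real^('n + 'n)^('n + 'n::finite) \<Rightarrow> bool"
  where "quantization_condition hbar \<Sigma> \<longleftrightarrow> pos_semidef_matrix (plus_i_times \<Sigma> ((hbar / 2) *\<^sub>R J_matrix))"

definition covariance_ellipsoid :: "real^'m^'m \<Rightarrow> (real^'m::finite) set"
  where "covariance_ellipsoid \<Sigma> = {z. 1 / 2 * ((matrix_inv \<Sigma> *v z) \<bullet> z) \<le> 1}"

definition symmetric_convex_body :: "(real^'n::finite) set \<Rightarrow> bool"
  where "symmetric_convex_body X \<longleftrightarrow> compact X \<and> convex X \<and> interior X \<noteq> {} \<and> uminus ` X = X"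

definition polar_dual :: "real \<Rightarrow> (real^'n::finite) set \<Rightarrow> (real^'n) set"
  where "polar_dual hbar X = {p. \<forall>x\<in>X. p \<bullet> x \<le> hbar}"

definition quantum_dual_pair :: "real \<Rightarrow> (real^'n::finite) set \<Rightarrow> (real^'n) set \<Rightarrow> bool"
  where "quantum_dual_pair hbar X P \<longleftrightarrow>
    symmetric_convex_body X \<and> symmetric_convex_body P \<and> polar_dual hbar X \<subseteq> P"

text \<open>The equivalent formulations in terms of \<open>M = (hbar / 2) \<Sigma>\<^sup>-\<^sup>1\<close>: the quantization condition is
  \<open>M\<^sup>-\<^sup>1 + i J \<ge> 0\<close>, and the covariance ellipsoid is \<open>{z. M z \<cdot> z \<le> hbar}\<close>.\<close>

lemma pos_def_matrix_invertible:
  fixes A :: "real^'m^'m::finite"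
  assumes "pos_def_matrix A"
  shows "invertible A"
proof -
  have "x = 0" if "A *v x = 0" for x
    using assms that by (metis inner_zero_left less_irrefl pos_def_matrix_def)
  then show ?thesis
    by (metis invertible_left_inverse matrix_left_invertible_ker)
qed

lemma covariance_ellipsoid_alt:
  fixes \<Sigma> :: "real^'m^'m::finite"
  assumes "hbar > 0"
  shows "covariance_ellipsoid \<Sigma> = {z. (((hbar / 2) *\<^sub>R matrix_inv \<Sigma>) *v z) \<bullet> z \<le> hbar}"
proof -
  have "(((hbar / 2) *\<^sub>R matrix_inv \<Sigma>) *v z) \<bullet> z = hbar * (1 / 2 * ((matrix_inv \<Sigma> *v z) \<bullet> z))" for z
    by (simp add: scaleR_matrix_vector_assoc [symmetric])
  moreover have "hbar * t \<le> hbar \<longleftrightarrow> t \<le> 1" for t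
    using assms by simp
  ultimately show ?thesis
    unfolding covariance_ellipsoid_def by presburger
qed

lemma pos_semidef_matrix_scale:
  fixes A B :: "real^'m^'m::finite"
  assumes "c > 0"
  shows "pos_semidef_matrix (plus_i_times (c *\<^sub>R A) (c *\<^sub>R B)) \<longleftrightarrow> pos_semidef_matrix (plus_i_times A B)"
proof -
  have K: "plus_i_times (c *\<^sub>R A) (c *\<^sub>R B) = c *\<^sub>R plus_i_times A B" (is "?L = c *\<^sub>R ?K")
    by (simp add: plus_i_times_def vec_eq_iff complex_eq_iff)
  have "hermitian_matrix (c *\<^sub>R ?K) \<longleftrightarrow> hermitian_matrix ?K"
    using assms by (simp add: hermitian_matrix_def vec_eq_iff transpose_def)
  moreover have "(\<Sum>j\<in>UNIV. cnj (v $ j) * ((c *\<^sub>R ?K) *v v) $ j)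
      = c *\<^sub>R (\<Sum>j\<in>UNIV. cnj (v $ j) * (?K *v v) $ j)" for v
    by (simp add: matrix_vector_mult_def scaleR_sum_right sum_distrib_left)
  ultimately show ?thesis
    unfolding K pos_semidef_matrix_def using assms by (simp add: zero_le_mult_iff)
qed

lemma quantization_condition_alt:
  fixes \<Sigma> :: "real^('n + 'n)^('n + 'n::finite)"
  assumes "hbar > 0" "pos_def_matrix \<Sigma>"
  defines "M \<equiv> (hbar / 2) *\<^sub>R matrix_inv \<Sigma>"
  shows "quantization_condition hbar \<Sigma> \<longleftrightarrow> pos_semidef_matrix (plus_i_times (matrix_inv M) J_matrix)"
proof -
  have \<Sigma>: "\<Sigma> ** matrix_inv \<Sigma> = mat 1 \<and> matrix_inv \<Sigma> ** \<Sigma> = mat 1"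
    using pos_def_matrix_invertible [OF assms(2)] unfolding invertible_def matrix_inv_def
    by (rule someI_ex)
  have 1: "M ** ((2 / hbar) *\<^sub>R \<Sigma>) = mat 1" and 2: "((2 / hbar) *\<^sub>R \<Sigma>) ** M = mat 1"
    using assms(1) \<Sigma> by (simp_all add: M_def matrix_scalar_ac flip: scalar_matrix_assoc)
  then have "invertible M"
    unfolding invertible_def by blast
  then have "M ** matrix_inv M = mat 1 \<and> matrix_inv M ** M = mat 1"
    unfolding invertible_def matrix_inv_def by (rule someI_ex)
  then have "matrix_inv M = (2 / hbar) *\<^sub>R \<Sigma>"
    using 2 1 by (metis matrix_mul_assoc matrix_mul_lid matrix_mul_rid)
  then have "\<Sigma> = (hbar / 2) *\<^sub>R matrix_inv M"
    using assms(1) by simp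
  then show ?thesis
    unfolding quantization_condition_def
    using assms(1) pos_semidef_matrix_scale [of "hbar / 2" "matrix_inv M" J_matrix] by simp
qed

end

theory Submission
  imports Defs
begin

text \<open>The support function of \<open>\<Omega>\<close> is \<open>w \<mapsto> sqrt (2 \<Sigma>w \<cdot> w)\<close>, so a point \<open>p\<close> of the polar dual of
  \<open>\<Omega>\<^sub>X\<close> satisfies \<open>2 \<Sigma>(p,0) \<cdot> (p,0) \<le> hbar\<^sup>2\<close>. Evaluating the quantization condition on complex
  vectors \<open>(p,0) + i (0,b)\<close> gives the uncertainty inequality
  \<open>\<Sigma>(p,0) \<cdot> (p,0) + \<Sigma>(0,b) \<cdot> (0,b) \<ge> hbar p \<cdot> b\<close>. For \<open>b\<close> a suitable multiple of \<open>y\<close> the two combine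
  to \<open>p \<cdot> y \<le> sqrt (2 \<Sigma>(0,y) \<cdot> (0,y))\<close>. The right-hand side is the support function of \<open>\<Omega>\<^sub>P\<close>, so
  \<open>p \<in> \<Omega>\<^sub>P\<close> by separation.\<close>

section \<open>Embeddings of position and momentum space into phase space\<close>

definition emb_X :: "real^'n \<Rightarrow> real^('n + 'n::finite)"
  where "emb_X x = (\<chi> k. case k of Inl i \<Rightarrow> x $ i | Inr i \<Rightarrow> 0)"

definition emb_P :: "real^'n \<Rightarrow> real^('n + 'n::finite)"
  where "emb_P p = (\<chi> k. case k of Inl i \<Rightarrow> 0 | Inr i \<Rightarrow> p $ i)"

lemma sum_UNIV_Plus:
  fixes f :: "'a::finite + 'b::finite \<Rightarrow> 'c::comm_monoid_add"
  shows "sum f UNIV = (\<Sum>i\<in>UNIV. f (Inl i)) + (\<Sum>i\<in>UNIV. f (Inr i))"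
  by (simp add: sum.Plus flip: UNIV_Plus_UNIV)

text \<open>The embedding is the adjoint of the projection, so the support function of a projected
  set at \<open>x\<close> is that of the original set at \<open>emb_X x\<close>.\<close>

lemma inner_emb_X: "z \<bullet> emb_X x = proj_X z \<bullet> x"
  by (simp add: inner_vec_def sum_UNIV_Plus emb_X_def proj_X_def)

lemma inner_emb_P: "z \<bullet> emb_P p = proj_P z \<bullet> p"
  by (simp add: inner_vec_def sum_UNIV_Plus emb_P_def proj_P_def)

lemma emb_P_scaleR: "emb_P (c *\<^sub>R p) = c *\<^sub>R emb_P p"
  by (simp add: emb_P_def vec_eq_iff split: sum.splits)

lemma linear_proj_X: "linear proj_X"
  by (rule linearI) (simp_all add: proj_X_def vec_eq_iff)

lemma linear_proj_P: "linear proj_P"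
  by (rule linearI) (simp_all add: proj_P_def vec_eq_iff)

lemma surj_proj_X: "surj proj_X"
  by (rule surjI [where f = emb_X]) (simp add: proj_X_def emb_X_def)

lemma surj_proj_P: "surj proj_P"
  by (rule surjI [where f = emb_P]) (simp add: proj_P_def emb_P_def)

lemma J_matrix_emb_X: "J_matrix *v emb_X x = - emb_P x"
  by (simp add: vec_eq_iff matrix_vector_mult_def sum_UNIV_Plus J_matrix_def emb_X_def emb_P_def
      if_distribR if_distrib [where f = "(*)"] sum_negf cong: if_cong split: sum.split)

lemma J_matrix_emb_P: "J_matrix *v emb_P p = emb_X p"
  by (simp add: vec_eq_iff matrix_vector_mult_def sum_UNIV_Plus J_matrix_def emb_X_def emb_P_def
      if_distribR if_distrib [where f = "(*)"] cong: if_cong split: sum.split)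

section \<open>Positive definite quadratic forms\<close>

lemma pos_def_matrix_inner_commute:
  assumes "pos_def_matrix A"
  shows "(A *v v) \<bullet> w = (A *v w) \<bullet> v"
  using assms unfolding pos_def_matrix_def by (metis dot_lmul_matrix inner_commute transpose_matrix_vector)

lemma pos_def_matrix_nonneg:
  assumes "pos_def_matrix A"
  shows "(A *v v) \<bullet> v \<ge> 0"
  using assms unfolding pos_def_matrix_def by (cases "v = 0") (auto intro: less_imp_le)

lemma matrix_inv_inverse:
  fixes A :: "real^'m^'m::finite"
  assumes "pos_def_matrix A"
  shows "A *v (matrix_inv A *v v) = v" "matrix_inv A *v (A *v v) = v"
proof -
  have "A ** matrix_inv A = mat 1 \<and> matrix_inv A ** A = mat 1"
    using pos_def_matrix_invertible [OF assms] unfolding invertible_def matrix_inv_def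
    by (rule someI_ex)
  then show "A *v (matrix_inv A *v v) = v" "matrix_inv A *v (A *v v) = v"
    by (simp_all add: matrix_vector_mul_assoc)
qed

text \<open>Substituting \<open>v = A *v u\<close> turns the form of the inverse into the form of
  \<open>A\<close>, which carries over both symmetry and positivity.\<close>

lemma pos_def_matrix_inv:
  fixes A :: "real^'m^'m::finite"
  assumes "pos_def_matrix A"
  shows "pos_def_matrix (matrix_inv A)"
  unfolding pos_def_matrix_def
proof (intro conjI allI impI)
  have "(matrix_inv A *v v) \<bullet> w = v \<bullet> (matrix_inv A *v w)" for v w
    using pos_def_matrix_inner_commute [OF assms, of "matrix_inv A *v v" "matrix_inv A *v w"]
    by (simp add: matrix_inv_inverse [OF assms] inner_commute)
  then have "(transpose (matrix_inv A) *v w) = matrix_inv A *v w" for w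
    by (metis dot_lmul_matrix inner_commute transpose_matrix_vector vector_eq_ldot)
  then show "transpose (matrix_inv A) = matrix_inv A"
    by (simp add: matrix_eq)
next
  fix v :: "real^'m"
  assume "v \<noteq> 0"
  then have "matrix_inv A *v v \<noteq> 0"
    using matrix_inv_inverse(1) [OF assms, of v] by auto
  then show "(matrix_inv A *v v) \<bullet> v > 0"
    using assms unfolding pos_def_matrix_def
    by (metis assms inner_commute matrix_inv_inverse(1))
qed

lemma continuous_on_quadratic_form:
  fixes A :: "real^'m^'m::finite"
  shows "continuous_on S (\<lambda>v. (A *v v) \<bullet> v)"
  by (intro continuous_intros linear_continuous_on matrix_vector_mul_bounded_linear)

text \<open>The constant is the minimum of the form over the compact unit sphere; homogeneity of
  degree two extends the bound to all vectors. It makes the ellipsoid bounded.\<close>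

lemma pos_def_matrix_coercive:
  fixes A :: "real^'m^'m::finite"
  assumes "pos_def_matrix A"
  obtains c where "c > 0" "\<And>v. c * (norm v)\<^sup>2 \<le> (A *v v) \<bullet> v"
proof -
  obtain u where u: "norm u = 1" "\<And>v. norm v = 1 \<Longrightarrow> (A *v u) \<bullet> u \<le> (A *v v) \<bullet> v"
    using continuous_attains_inf [of "sphere 0 1" "\<lambda>v. (A *v v) \<bullet> v"] continuous_on_quadratic_form
    by (force simp: sphere_eq_empty)
  have "(A *v u) \<bullet> u * (norm v)\<^sup>2 \<le> (A *v v) \<bullet> v" for v
  proof (cases "v = 0")
    case False
    then show ?thesis
      using u(2) [of "v /\<^sub>R norm v"]
      by (simp add: matrix_vector_mult_scaleR field_simps power2_eq_square)
  qed simp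
  moreover have "(A *v u) \<bullet> u > 0"
    using assms u(1) unfolding pos_def_matrix_def by (metis norm_zero zero_neq_one)
  ultimately show thesis
    by (rule that [rotated])
qed

section \<open>Ellipsoids and their linear images as convex bodies\<close>

lemma symmetric_convex_body_ellipsoid:
  fixes A :: "real^'m^'m::finite"
  assumes A: "pos_def_matrix A" and "r > 0"
  shows "symmetric_convex_body {z. (A *v z) \<bullet> z \<le> r}" (is "symmetric_convex_body ?E")
  unfolding symmetric_convex_body_def
proof (intro conjI)
  obtain c where c: "c > 0" "\<And>v. c * (norm v)\<^sup>2 \<le> (A *v v) \<bullet> v"
    using pos_def_matrix_coercive [OF A] by metis
  have "norm z \<le> sqrt (r / c)" if "z \<in> ?E" for z
    using c(2) [of z] that c(1) by (intro real_le_rsqrt) (simp add: field_simps)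
  then have "bounded ?E"
    unfolding bounded_iff by blast
  moreover have "closed ?E"
    by (intro closed_Collect_le continuous_on_quadratic_form continuous_on_const)
  ultimately show "compact ?E"
    by (simp add: compact_eq_bounded_closed)
  show "convex ?E"
  proof (rule convexI)
    fix z w and s t :: real
    assume zw: "z \<in> ?E" "w \<in> ?E" and st: "0 \<le> s" "0 \<le> t" "s + t = 1"
    define Q where "Q v = (A *v v) \<bullet> v" for v
    have t: "t = 1 - s"
      using st by simp
    \<comment> \<open>Convexity of \<open>Q\<close> in exact form: the defect is
      \<open>s * t * Q (z - w)\<close>, which is nonnegative.\<close>
    have "Q (s *\<^sub>R z + t *\<^sub>R w) = s * Q z + t * Q w - s * t * Q (z - w)"
      using pos_def_matrix_inner_commute [OF A, of w z] unfolding Q_def t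
      by (simp add: matrix_vector_right_distrib matrix_vector_mult_diff_distrib
          matrix_vector_mult_scaleR inner_simps algebra_simps)
    also have "\<dots> \<le> s * Q z + t * Q w"
      using st pos_def_matrix_nonneg [OF A] by (simp add: Q_def)
    also have "\<dots> \<le> s * r + t * r"
      using zw st by (intro add_mono mult_left_mono) (auto simp: Q_def)
    also have "\<dots> = r"
      using st by (simp flip: distrib_right)
    finally show "s *\<^sub>R z + t *\<^sub>R w \<in> ?E"
      by (simp add: Q_def)
  qed
  have "open {z. (A *v z) \<bullet> z < r}"
    by (intro open_Collect_less continuous_on_quadratic_form continuous_on_const)
  moreover have "0 \<in> {z. (A *v z) \<bullet> z < r}"
    using \<open>r > 0\<close> by simp
  moreover have "{z. (A *v z) \<bullet> z < r} \<subseteq> ?E"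
    by auto
  ultimately have "0 \<in> interior ?E"
    by (rule interiorI)
  then show "interior ?E \<noteq> {}"
    by blast
  have neg: "- z \<in> ?E" if "z \<in> ?E" for z
    using that matrix_vector_mult_scaleR [of A "- 1" z] by simp
  show "uminus ` ?E = ?E"
  proof
    show "uminus ` ?E \<subseteq> ?E"
      using neg by blast
    show "?E \<subseteq> uminus ` ?E"
      using neg by (metis (no_types, lifting) add.inverse_inverse imageI subsetI)
  qed
qed

text \<open>Surjectivity makes \<open>f\<close> an open map, so the image keeps a nonempty
  interior.\<close>

lemma symmetric_convex_body_linear_image:
  fixes f :: "real^'m::finite \<Rightarrow> real^'n::finite"
  assumes f: "linear f" "surj f" and S: "symmetric_convex_body S"
  shows "symmetric_convex_body (f ` S)"
  unfolding symmetric_convex_body_def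
proof (intro conjI)
  show "compact (f ` S)"
    using S f unfolding symmetric_convex_body_def
    by (intro compact_continuous_image linear_continuous_on linear_conv_bounded_linear [THEN iffD1]) auto
  show "convex (f ` S)"
    using S f by (simp add: symmetric_convex_body_def convex_linear_image)
  have "open (f ` interior S)"
    using f by (intro open_surjective_linear_image) auto
  then have "f ` interior S \<subseteq> interior (f ` S)"
    by (simp add: image_mono interior_maximal interior_subset)
  then show "interior (f ` S) \<noteq> {}"
    using S by (auto simp: symmetric_convex_body_def)
  have "uminus ` f ` S = f ` uminus ` S"
    using f by (simp add: image_image linear_neg)
  then show "uminus ` f ` S = f ` S"
    using S by (simp add: symmetric_convex_body_def)
qed

section \<open>Support function of the ellipsoid and the uncertainty inequality\<close>

lemma covariance_ellipsoid_support:
  fixes \<Sigma> :: "real^'m^'m::finite"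
  assumes "pos_def_matrix \<Sigma>"
  obtains z where "z \<in> covariance_ellipsoid \<Sigma>" "z \<bullet> w = sqrt (2 * ((\<Sigma> *v w) \<bullet> w))"
proof (cases "w = 0")
  case True
  then show thesis
    using that [of 0] by (simp add: covariance_ellipsoid_def)
next
  case False
  define s where "s = (\<Sigma> *v w) \<bullet> w"
  have s: "s > 0"
    using assms False by (simp add: s_def pos_def_matrix_def)
  \<comment> \<open>By the Lagrange condition a maximizer of the functional \<open>w\<close> over
    the ellipsoid is a multiple of \<open>\<Sigma> *v w\<close>; the factor puts it on the
    boundary.\<close>
  define z where "z = sqrt (2 / s) *\<^sub>R (\<Sigma> *v w)"
  have "(matrix_inv \<Sigma> *v z) \<bullet> z = 2 / s * s"
    using s by (simp add: z_def matrix_vector_mult_scaleR matrix_inv_inverse [OF assms]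
        inner_commute s_def flip: mult.assoc)
  then have "z \<in> covariance_ellipsoid \<Sigma>"
    using s by (simp add: covariance_ellipsoid_def)
  moreover have "z \<bullet> w = sqrt (2 * s)"
  proof -
    have "z \<bullet> w = sqrt 2 * (s / sqrt s)"
      by (simp add: z_def s_def [symmetric] real_sqrt_divide)
    then show ?thesis
      using s by (simp only: real_div_sqrt less_imp_le real_sqrt_mult)
  qed
  ultimately show thesis
    using that by (simp add: s_def)
qed

text \<open>This is the real part of the hermitian form at the complex vector
  \<open>u + i v\<close>, expanded into real bilinear forms.\<close>

lemma pos_semidef_matrix_plus_i_times_bound:
  fixes A B :: "real^'m^'m::finite"
  assumes "pos_semidef_matrix (plus_i_times A B)"
  shows "(B *v v) \<bullet> u - (B *v u) \<bullet> v \<le> (A *v u) \<bullet> u + (A *v v) \<bullet> v"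
proof -
  define V where "V = (\<chi> k. Complex (u $ k) (v $ k))"
  have "Re (cnj (V $ j) * (plus_i_times A B *v V) $ j)
      = (A *v u) $ j * u $ j + (A *v v) $ j * v $ j - (B *v v) $ j * u $ j + (B *v u) $ j * v $ j"
    for j
    by (simp add: V_def plus_i_times_def matrix_vector_mult_def sum_subtractf sum.distrib sum_negf
        algebra_simps)
  then have "Re (\<Sum>j\<in>UNIV. cnj (V $ j) * (plus_i_times A B *v V) $ j)
      = (A *v u) \<bullet> u + (A *v v) \<bullet> v - (B *v v) \<bullet> u + (B *v u) \<bullet> v"
    by (simp add: inner_vec_def sum_subtractf sum.distrib)
  moreover have "Re (\<Sum>j\<in>UNIV. cnj (V $ j) * (plus_i_times A B *v V) $ j) \<ge> 0"
    using assms unfolding pos_semidef_matrix_def by blast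
  ultimately show ?thesis
    by linarith
qed

lemma quantization_condition_uncertainty:
  fixes \<Sigma> :: "real^('n + 'n)^('n + 'n::finite)"
  assumes "quantization_condition hbar \<Sigma>"
  shows "hbar * (a \<bullet> b) \<le> (\<Sigma> *v emb_X a) \<bullet> emb_X a + (\<Sigma> *v emb_P b) \<bullet> emb_P b"
proof -
  have "proj_X (emb_X b) = b" "proj_P (emb_P a) = a"
    by (simp_all add: proj_X_def emb_X_def proj_P_def emb_P_def)
  \<comment> \<open>\<open>J_matrix\<close> swaps the two embeddings up to sign, so each of the two
    terms contributes \<open>(hbar / 2) * (a \<bullet> b)\<close>.\<close>
  then have "(((hbar / 2) *\<^sub>R J_matrix) *v emb_P b) \<bullet> emb_X a
      - (((hbar / 2) *\<^sub>R J_matrix) *v emb_X a) \<bullet> emb_P b = hbar * (a \<bullet> b)"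
    by (simp add: J_matrix_emb_X J_matrix_emb_P inner_emb_X inner_emb_P inner_commute [of b]
        linear_cmul [OF linear_proj_X] linear_cmul [OF linear_proj_P] linear_neg [OF linear_proj_P]
        flip: scaleR_matrix_vector_assoc)
  then show ?thesis
    using pos_semidef_matrix_plus_i_times_bound
        [of \<Sigma> "(hbar / 2) *\<^sub>R J_matrix" "emb_P b" "emb_X a"] assms
    by (simp add: quantization_condition_def)
qed

theorem theorem10:
  fixes hbar :: real
    and \<Sigma> :: "real^('n + 'n)^('n + 'n::finite)"
  assumes "hbar > 0"
    and "pos_def_matrix \<Sigma>"
    and "quantization_condition hbar \<Sigma>"
  shows "quantum_dual_pair hbar (proj_X ` covariance_ellipsoid \<Sigma>) (proj_P ` covariance_ellipsoid \<Sigma>)"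
proof -
  let ?\<Omega> = "covariance_ellipsoid \<Sigma>"
  have "?\<Omega> = {z. (matrix_inv \<Sigma> *v z) \<bullet> z \<le> 2}"
    by (auto simp: covariance_ellipsoid_def)
  then have body: "symmetric_convex_body ?\<Omega>"
    using symmetric_convex_body_ellipsoid [OF pos_def_matrix_inv [OF assms(2)], of 2] by simp
  have body_X: "symmetric_convex_body (proj_X ` ?\<Omega>)"
    by (intro symmetric_convex_body_linear_image linear_proj_X surj_proj_X body)
  have body_P: "symmetric_convex_body (proj_P ` ?\<Omega>)"
    by (intro symmetric_convex_body_linear_image linear_proj_P surj_proj_P body)
  have "polar_dual hbar (proj_X ` ?\<Omega>) \<subseteq> proj_P ` ?\<Omega>"
  proof (rule subsetI, rule ccontr)
    fix p
    assume p: "p \<in> polar_dual hbar (proj_X ` ?\<Omega>)" and "p \<notin> proj_P ` ?\<Omega>"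
    moreover have "convex (proj_P ` ?\<Omega>)" "closed (proj_P ` ?\<Omega>)"
      using body_P by (simp_all add: symmetric_convex_body_def compact_imp_closed)
    ultimately obtain y b where y: "y \<bullet> p < b" "\<And>q. q \<in> proj_P ` ?\<Omega> \<Longrightarrow> y \<bullet> q > b"
      using separating_hyperplane_closed_point by metis
    define A where "A = (\<Sigma> *v emb_X p) \<bullet> emb_X p"
    \<comment> \<open>The hyperplane leaves \<open>p\<close> on its lower side, so
      \<open>- y\<close> is the direction in which \<open>p\<close> lies strictly beyond the
      projected ellipsoid.\<close>
    define B where "B = (\<Sigma> *v emb_P (- y)) \<bullet> emb_P (- y)"
    obtain z where z: "z \<in> ?\<Omega>" "z \<bullet> emb_X p = sqrt (2 * A)"
      using covariance_ellipsoid_support [OF assms(2)] unfolding A_def by blast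
    then have "p \<bullet> proj_X z \<le> hbar"
      using p by (simp add: polar_dual_def)
    then have "sqrt (2 * A) \<le> hbar"
      using z(2) by (simp add: inner_emb_X inner_commute)
    then have A: "2 * A \<le> hbar\<^sup>2"
      by (rule sqrt_le_D)
    obtain z' where z': "z' \<in> ?\<Omega>" "z' \<bullet> emb_P (- y) = sqrt (2 * B)"
      using covariance_ellipsoid_support [OF assms(2)] unfolding B_def by blast
    define r where "r = sqrt (2 * B)"
    \<comment> \<open>The number \<open>r\<close> is a value of the functional \<open>- y\<close> on
      the projection, attained at \<open>proj_P z'\<close>, so separation puts it strictly below the
      value at \<open>p\<close>.\<close>
    have less: "r < p \<bullet> (- y)"
      using y(1) y(2) [of "proj_P z'"] z' by (simp add: r_def inner_emb_P inner_commute)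
    have B: "B \<ge> 0" "2 * B = r\<^sup>2"
      using pos_def_matrix_nonneg [OF assms(2)] by (simp_all add: r_def B_def)
    \<comment> \<open>Rescaling \<open>- y\<close> by a free \<open>c\<close> leaves the left side
      linear and the right side quadratic in \<open>c\<close>; the contradiction comes from choosing
      \<open>c\<close>.\<close>
    have *: "hbar * c * (p \<bullet> (- y)) \<le> hbar\<^sup>2 / 2 + (c * r)\<^sup>2 / 2" for c
    proof -
      have "hbar * c * (p \<bullet> (- y)) \<le> A + c\<^sup>2 * B"
        using quantization_condition_uncertainty [OF assms(3), of p "c *\<^sub>R (- y)"]
        unfolding emb_P_scaleR
        by (simp add: matrix_vector_mult_scaleR A_def [symmetric] B_def [symmetric]
            power2_eq_square mult.assoc del: inner_minus_right scaleR_minus_right)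
      also have "c\<^sup>2 * B = (c * r)\<^sup>2 / 2"
        by (simp add: power_mult_distrib flip: B(2))
      finally show ?thesis
        using A by linarith
    qed
    show False
    proof (cases "r = 0")
      case True
      \<comment> \<open>The right side is now the constant \<open>hbar\<^sup>2 / 2\<close>, and this
        \<open>c\<close> raises the left side to \<open>hbar\<^sup>2\<close>. The choice
        \<open>hbar / r\<close> would be \<open>0\<close> here and give nothing.\<close>
      then show False
        using * [of "hbar / (p \<bullet> (- y))"] less assms(1) by (simp add: power2_eq_square)
    next
      case False
      then have "r > 0"
        using B(1) by (simp add: r_def)
      \<comment> \<open>The choice \<open>c = hbar / r\<close> balances the two terms on the right:
        they sum to \<open>hbar\<^sup>2\<close>, which the left side strictly exceeds.\<close>
      then have "hbar * (hbar / r) * r < hbar * (hbar / r) * (p \<bullet> (- y))"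
        using less assms(1) by (intro mult_strict_left_mono) auto
      then show False
        using * [of "hbar / r"] \<open>r > 0\<close> by (simp add: power2_eq_square del: inner_minus_right)
    qed
  qed
  then show ?thesis
    using body_X body_P by (simp add: quantum_dual_pair_def)
qed

end
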